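(* Let $\Omega$ be a topological space, let $M\subset C(\Omega,[0,1])$ be a multiplier of itself, i.e. $\varphi f+(1-\varphi)g\in M$ for all $\varphi,f,g\in M$, and let $S$ be a closed subset of $\Omega$. Assume that (i) $M$ separates $\Omega\setminus S$, i.e. for all $x\neq y$ in $\Omega\setminus S$ there is $m\in M$ with $m(x)\ne m(y)$; (ii) for every $t\in\Omega\setminus S$ there exist $m_{1,t},m_{2,t},m_{3,t}\in M$ such that $m_{1,t}(t)=0$, $m_{2,t}(t)=1$ and $0<m_{3,t}(t)<1$; (iii) $M|_S=\{0\}$, i.e. every $m\in M$ vanishes on $S$. Then $\overline{M}=\{f\in C(\Omega,[0,1]): f|_S=0\}$, where the topology is taken as the compact-open topology or the strict topology.
   Context: $\Omega$ is not assumed Hausdorff. $C(\Omega,[0,1])$ is the set of continuous functions $\Omega\to[0,1]$. $C_0(\Omega,\mathbb{R}_+)$ is the set of continuous functions $v:\Omega\to[0,\infty)$ such that $\{x:v(x)\ge\epsilon\}$ is compact for every $\epsilon>0$. The compact-open topology is the topology of uniform convergence on compact subsets of $\Omega$. The strict topology on the space of bounded continuous functions is the topology with local base at $0$ given by the sets $\{f:\sup_{x\in\Omega}v(x)|f(x)|<\epsilon\}$, $v\in C_0(\Omega,\mathbb{R}_+)$, $\epsilon>0$.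
   Formalization: For the strict topology equality fails in general (Ω=ℚ, S={0}); it is proved if each point of S (closure in C(Ω,[0,1])) or of Ω (closure among bounded continuous functions) has v∈C_0(Ω,ℝ_+) with v(x)>0; the inclusion ⊇ is unconditional. *)

theory Defs
  imports "HOL-Analysis.Analysis"
begin

definition cont_funs :: "('a::topological_space \<Rightarrow> real) set" where
  "cont_funs = {f. continuous_on UNIV f}"

definition unit_cont_funs :: "('a::topological_space \<Rightarrow> real) set" where
  "unit_cont_funs = {f. continuous_on UNIV f \<and> range f \<subseteq> {0..1}}"

definition C0_weights :: "('a::topological_space \<Rightarrow> real) set" where
  "C0_weights = {v. continuous_on UNIV v \<and> (\<forall>x. 0 \<le> v x) \<and> (\<forall>e>0. compact {x. e \<le> v x})}"

definition self_multiplier :: "('a \<Rightarrow> real) set \<Rightarrow> bool" where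
  "self_multiplier M \<longleftrightarrow>
     (\<forall>p\<in>M. \<forall>f\<in>M. \<forall>g\<in>M. (\<lambda>x. p x * f x + (1 - p x) * g x) \<in> M)"

text \<open>The two function-space topologies are given by their neighbourhoods; the lemmas
  \<open>openin_compact_open\<close> and \<open>openin_strict\<close> below confirm that the predicates are topologies.\<close>

definition compact_open_topology :: "('a::topological_space \<Rightarrow> real) topology" where
  "compact_open_topology = topology (\<lambda>U. U \<subseteq> cont_funs \<and>
     (\<forall>f\<in>U. \<exists>K e. compact K \<and> 0 < e \<and> {g \<in> cont_funs. \<forall>x\<in>K. \<bar>g x - f x\<bar> < e} \<subseteq> U))"

text \<open>The suprema below are taken over bounded sets, since weights and members of
  \<^const>\<open>bcontfun\<close> are bounded, so they are genuine real suprema.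
  Without local compactness there may be few weights, and the strict topology need not refine
  pointwise convergence: if no point has a compact neighbourhood, then \<^const>\<open>C0_weights\<close>
  contains only \<open>0\<close> and the strict topology is indiscrete.\<close>

definition strict_topology :: "('a::topological_space \<Rightarrow> real) topology" where
  "strict_topology = topology (\<lambda>U. U \<subseteq> bcontfun \<and>
     (\<forall>f\<in>U. \<exists>v\<in>C0_weights. \<exists>e>0. {g \<in> bcontfun. (SUP x. v x * \<bar>g x - f x\<bar>) < e} \<subseteq> U))"

lemma openin_compact_open:
  "openin compact_open_topology U \<longleftrightarrow> U \<subseteq> cont_funs \<and>
     (\<forall>f\<in>U. \<exists>K e. compact K \<and> 0 < e \<and> {g \<in> cont_funs. \<forall>x\<in>K. \<bar>g x - f x\<bar> < e} \<subseteq> U)"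
proof -
  let ?N = "\<lambda>f K e. {g \<in> cont_funs. \<forall>x\<in>K. \<bar>g x - f x\<bar> < e} :: ('a \<Rightarrow> real) set"
  let ?P = "\<lambda>U. U \<subseteq> cont_funs \<and> (\<forall>f\<in>U. \<exists>K e. compact K \<and> 0 < e \<and> ?N f K e \<subseteq> U)"
  have "istopology ?P"
    unfolding istopology_def
  proof (rule conjI; intro allI impI)
    fix A B assume A: "?P A" and B: "?P B"
    show "?P (A \<inter> B)"
    proof (intro conjI ballI)
      show "A \<inter> B \<subseteq> cont_funs" using A by blast
      fix f assume f: "f \<in> A \<inter> B"
      obtain K d where 1: "compact K" "0 < d" "?N f K d \<subseteq> A" using A f by blast
      obtain L e where 2: "compact L" "0 < e" "?N f L e \<subseteq> B" using B f by blast
      have "?N f (K \<union> L) (min d e) \<subseteq> ?N f K d \<inter> ?N f L e" by auto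
      then have "?N f (K \<union> L) (min d e) \<subseteq> A \<inter> B" using 1(3) 2(3) by blast
      moreover have "compact (K \<union> L)" "0 < min d e" using 1 2 by auto
      ultimately show "\<exists>K e. compact K \<and> 0 < e \<and> ?N f K e \<subseteq> A \<inter> B" by blast
    qed
  next
    fix \<U> assume U: "\<forall>A\<in>\<U>. ?P A"
    show "?P (\<Union>\<U>)"
    proof (intro conjI ballI)
      show "\<Union>\<U> \<subseteq> cont_funs" using U by blast
      fix f assume "f \<in> \<Union>\<U>"
      then obtain A where A: "A \<in> \<U>" "f \<in> A" by blast
      have "?P A" using U A(1) by (rule bspec)
      then obtain K e where "compact K" "0 < e" "?N f K e \<subseteq> A" using A(2) by blast
      moreover have "A \<subseteq> \<Union>\<U>" using A(1) by blast
      ultimately show "\<exists>K e. compact K \<and> 0 < e \<and> ?N f K e \<subseteq> \<Union>\<U>"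
        by (meson order_trans)
    qed
  qed
  then show ?thesis
    by (simp add: compact_open_topology_def topology_inverse')
qed

lemma C0_weights_bounded:
  assumes "v \<in> C0_weights"
  obtains B where "\<And>x. v x \<le> B"
proof -
  have c: "continuous_on UNIV v" and k: "compact {x. 1 \<le> v x}"
    using assms by (auto simp: C0_weights_def)
  have "compact (v ` {x. 1 \<le> v x})"
    using c k by (meson compact_continuous_image continuous_on_subset subset_UNIV)
  then obtain B where "\<forall>y\<in>v ` {x. 1 \<le> v x}. norm y \<le> B"
    using compact_imp_bounded bounded_iff by metis
  then have "v x \<le> max B 1" for x
    by (cases "1 \<le> v x") force+
  then show thesis using that by blast
qed

lemma weighted_bdd_above:
  fixes f g :: "'a::topological_space \<Rightarrow> real"
  assumes v: "v \<in> C0_weights" and f: "f \<in> bcontfun" and g: "g \<in> bcontfun"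
  shows "bdd_above (range (\<lambda>x. v x * \<bar>g x - f x\<bar>))"
proof -
  obtain B where B: "\<And>x. v x \<le> B" using C0_weights_bounded[OF v] by blast
  obtain F where F: "\<And>x. \<bar>f x\<bar> \<le> F" using f by (auto simp: bcontfun_def bounded_iff)
  obtain G where G: "\<And>x. \<bar>g x\<bar> \<le> G" using g by (auto simp: bcontfun_def bounded_iff)
  have "v x * \<bar>g x - f x\<bar> \<le> B * (G + F)" for x
  proof (rule mult_mono)
    show "\<bar>g x - f x\<bar> \<le> G + F" using F[of x] G[of x] by linarith
    have "0 \<le> v x" using v by (auto simp: C0_weights_def)
    then show "0 \<le> B" using B[of x] by linarith
  qed (use B in auto)
  then show ?thesis by (rule bdd_aboveI2)
qed

lemma C0_weights_max:
  assumes "v \<in> C0_weights" "w \<in> C0_weights"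
  shows "(\<lambda>x. max (v x) (w x)) \<in> C0_weights"
proof -
  have "{x. e \<le> max (v x) (w x)} = {x. e \<le> v x} \<union> {x. e \<le> w x}" for e
    by auto
  then show ?thesis
    using assms by (auto simp: C0_weights_def le_max_iff_disj intro!: continuous_on_max)
qed

lemma openin_strict:
  "openin strict_topology U \<longleftrightarrow> U \<subseteq> bcontfun \<and>
     (\<forall>f\<in>U. \<exists>v\<in>C0_weights. \<exists>e>0. {g \<in> bcontfun. (SUP x. v x * \<bar>g x - f x\<bar>) < e} \<subseteq> U)"
proof -
  let ?N = "\<lambda>f v e. {g \<in> bcontfun. (SUP x. v x * \<bar>g x - f x\<bar>) < e} :: ('a \<Rightarrow> real) set"
  let ?P = "\<lambda>U. U \<subseteq> bcontfun \<and> (\<forall>f\<in>U. \<exists>v\<in>C0_weights. \<exists>e>0. ?N f v e \<subseteq> U)"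
  have mono: "?N f w (min d e) \<subseteq> ?N f v d"
    if "v \<in> C0_weights" "w \<in> C0_weights" "\<And>x. v x \<le> w x" "f \<in> bcontfun" for f v w d e
  proof
    fix g assume g: "g \<in> ?N f w (min d e)"
    have "(SUP x. v x * \<bar>g x - f x\<bar>) \<le> (SUP x. w x * \<bar>g x - f x\<bar>)"
    proof (rule cSUP_mono)
      show "bdd_above (range (\<lambda>x. w x * \<bar>g x - f x\<bar>))"
        using that g by (intro weighted_bdd_above) auto
      show "\<exists>y\<in>UNIV. v x * \<bar>g x - f x\<bar> \<le> w y * \<bar>g y - f y\<bar>" for x
        using mult_right_mono[OF that(3)[of x] abs_ge_zero] by blast
    qed simp
    then show "g \<in> ?N f v d" using g by auto
  qed
  have "istopology ?P"
    unfolding istopology_def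
  proof (rule conjI; intro allI impI)
    fix A B assume A: "?P A" and B: "?P B"
    show "?P (A \<inter> B)"
    proof (intro conjI ballI)
      show "A \<inter> B \<subseteq> bcontfun" using A by blast
      fix f assume f: "f \<in> A \<inter> B"
      then have fb: "f \<in> bcontfun" using A by blast
      obtain v d where 1: "v \<in> C0_weights" "0 < d" "?N f v d \<subseteq> A" using A f by blast
      obtain w e where 2: "w \<in> C0_weights" "0 < e" "?N f w e \<subseteq> B" using B f by blast
      let ?u = "\<lambda>x. max (v x) (w x)"
      have u: "?u \<in> C0_weights" by (rule C0_weights_max[OF 1(1) 2(1)])
      have "?N f ?u (min d e) \<subseteq> ?N f v d"
        by (rule mono) (use u 1 fb in auto)
      then have uA: "?N f ?u (min d e) \<subseteq> A"
        using 1(3) by (rule order_trans)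
      have "?N f ?u (min e d) \<subseteq> ?N f w e"
        by (rule mono) (use u 2 fb in auto)
      then have "?N f ?u (min e d) \<subseteq> B"
        using 2(3) by (rule order_trans)
      then have uB: "?N f ?u (min d e) \<subseteq> B"
        by (subst min.commute)
      show "\<exists>v\<in>C0_weights. \<exists>e>0. ?N f v e \<subseteq> A \<inter> B"
        by (intro bexI[OF _ u] exI[of _ "min d e"] conjI Int_greatest uA uB) (use 1 2 in auto)
    qed
  next
    fix \<U> assume U: "\<forall>A\<in>\<U>. ?P A"
    show "?P (\<Union>\<U>)"
    proof (intro conjI ballI)
      show "\<Union>\<U> \<subseteq> bcontfun" using U by blast
      fix f assume "f \<in> \<Union>\<U>"
      then obtain A where A: "A \<in> \<U>" "f \<in> A" by blast
      have "?P A" using U A(1) by (rule bspec)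
      then obtain v e where "v \<in> C0_weights" "0 < e" "?N f v e \<subseteq> A" using A(2) by blast
      moreover have "A \<subseteq> \<Union>\<U>" using A(1) by blast
      ultimately show "\<exists>v\<in>C0_weights. \<exists>e>0. ?N f v e \<subseteq> \<Union>\<U>"
        by (meson order_trans)
    qed
  qed
  then show ?thesis
    by (simp add: strict_topology_def topology_inverse')
qed

end

(* Idea: the set of all multipliers of M contains M and, unlike M, is closed under complements
   p |-> 1 - p and products. Hence (1 - p^m)^n is a multiplier whenever p is, and these sharpen
   any separation of points into functions that are almost 1 near a given point and almost 0
   away from it. Such functions glue local approximants from M of a target f on a compact set.
   At a point outside S local approximants exist because {m t | m in M} is dense in [0,1]. *)

theory Submission
  imports Defs
begin

section \<open>The algebra of multipliers\<close>

text \<open>Continuity makes the sets \<open>{z. p z < a}\<close> and \<open>{z. b < p z}\<close>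
  open, and values in \<open>{0..1}\<close> make every gluing a pointwise convex combination; hence
  the restriction to \<open>unit_cont_funs\<close>.\<close>

definition multipliers :: "('a::topological_space \<Rightarrow> real) set \<Rightarrow> ('a \<Rightarrow> real) set" where
  "multipliers M = {p \<in> unit_cont_funs. \<forall>f\<in>M. \<forall>g\<in>M. (\<lambda>x. p x * f x + (1 - p x) * g x) \<in> M}"

lemma unit_cont_funsD:
  assumes "p \<in> unit_cont_funs"
  shows "continuous_on UNIV p" "0 \<le> p x" "p x \<le> 1"
  using assms by (auto simp: unit_cont_funs_def image_subset_iff)

lemma multipliers_unit: "p \<in> multipliers M \<Longrightarrow> p \<in> unit_cont_funs"
  by (simp add: multipliers_def)

lemma multipliersD:
  "p \<in> multipliers M \<Longrightarrow> f \<in> M \<Longrightarrow> g \<in> M \<Longrightarrow> (\<lambda>x. p x * f x + (1 - p x) * g x) \<in> M"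
  by (simp add: multipliers_def)

lemma subset_multipliers:
  assumes "M \<subseteq> unit_cont_funs" "self_multiplier M"
  shows "M \<subseteq> multipliers M"
  using assms by (auto simp: multipliers_def self_multiplier_def)

lemma multipliers_one: "(\<lambda>_. 1) \<in> multipliers M"
  by (simp add: multipliers_def unit_cont_funs_def)

text \<open>Passing to the complement only exchanges the roles of \<open>f\<close> and
  \<open>g\<close>.\<close>

lemma multipliers_complement:
  assumes "p \<in> multipliers M"
  shows "(\<lambda>x. 1 - p x) \<in> multipliers M"
proof -
  have "(\<lambda>x. (1 - p x) * f x + (1 - (1 - p x)) * g x) \<in> M" if "f \<in> M" "g \<in> M" for f g
    using multipliersD[OF assms that(2,1)] by (simp add: add.commute)
  then show ?thesis
    using assms
    by (auto simp: multipliers_def unit_cont_funs_def image_subset_iff intro!: continuous_intros)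
qed

text \<open>Nesting two combinations with the same second function multiplies the weights: \<open>p
  * (q * f + (1 - q) * g) + (1 - p) * g = p * q * f + (1 - p * q) * g\<close>.\<close>

lemma multipliers_mult:
  assumes p: "p \<in> multipliers M" and q: "q \<in> multipliers M"
  shows "(\<lambda>x. p x * q x) \<in> multipliers M"
proof -
  have "(\<lambda>x. p x * q x * f x + (1 - p x * q x) * g x) \<in> M" if "f \<in> M" "g \<in> M" for f g
    using multipliersD[OF p multipliersD[OF q that] that(2)] by (simp add: algebra_simps)
  moreover have "(\<lambda>x. p x * q x) \<in> unit_cont_funs"
    using unit_cont_funsD[OF multipliers_unit[OF p]] unit_cont_funsD[OF multipliers_unit[OF q]]
    by (auto simp: unit_cont_funs_def intro!: continuous_intros mult_le_one)
  ultimately show ?thesis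
    by (simp add: multipliers_def)
qed

lemma multipliers_power: "p \<in> multipliers M \<Longrightarrow> (\<lambda>x. p x ^ n) \<in> multipliers M"
  by (induction n) (auto intro: multipliers_one multipliers_mult)

section \<open>Sharpening by powers, and separation of a point from a compact set\<close>

text \<open>With \<open>a < c < b\<close>, take \<open>n\<close> of the order of \<open>c\<close> to the power \<open>- m\<close>: then \<open>n * a ^ m\<close> tends
  to 0 and \<open>n * b ^ m\<close> to infinity as \<open>m\<close> grows.\<close>

lemma power_sharpening:
  fixes a b d :: real
  assumes "0 \<le> a" "a < b" "b \<le> 1" "0 < d"
  obtains m n where "\<And>t. 0 \<le> t \<Longrightarrow> t \<le> a \<Longrightarrow> 1 - d < (1 - t ^ m) ^ n"
    and "\<And>t. b \<le> t \<Longrightarrow> t \<le> 1 \<Longrightarrow> (1 - t ^ m) ^ n < d"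
proof -
  define c where "c = (a + b) / 2"
  have c: "0 < c" "a < c" "c < b" "c \<le> 1" using assms by (auto simp: c_def)
  have "(\<lambda>m. 2 * (a / c) ^ m) \<longlonglongrightarrow> 2 * 0"
    using assms c by (intro tendsto_intros LIMSEQ_realpow_zero) auto
  moreover have "(\<lambda>m. (c / b) ^ m) \<longlonglongrightarrow> 0"
    using assms c by (intro LIMSEQ_realpow_zero) auto
  ultimately have "\<forall>\<^sub>F m in sequentially. 2 * (a / c) ^ m < d \<and> (c / b) ^ m < d"
    using assms by (intro eventually_conj order_tendstoD(2)) auto
  then obtain m where m: "2 * (a / c) ^ m < d" "(c / b) ^ m < d"
    by (auto simp: eventually_sequentially)
  define n where "n = nat \<lceil>(1 / c) ^ m\<rceil>"
  \<comment> \<open>A number that is at least 1 is at most doubled by rounding up; this is the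
    factor 2 in the choice of \<open>m\<close>.\<close>
  have one: "1 \<le> (1 / c) ^ m" using c by (simp add: one_le_power)
  have n: "(1 / c) ^ m \<le> real n" "real n \<le> 2 * (1 / c) ^ m"
    using one unfolding n_def by linarith+
  show thesis
  proof
    fix t assume t: "0 \<le> t" "t \<le> a"
    have "t \<le> 1" using t assms by simp
    then have le: "t ^ m \<le> 1" using t by (simp add: power_le_one)
    have "real n * t ^ m \<le> 2 * (1 / c) ^ m * a ^ m"
      using n t assms by (intro mult_mono power_mono) auto
    also have "\<dots> = 2 * (a / c) ^ m" by (simp add: power_divide)
    finally have "real n * t ^ m < d" using m by simp
    moreover have "1 + real n * (- (t ^ m)) \<le> (1 + - (t ^ m)) ^ n"
      using le by (intro Bernoulli_inequality) simp
    ultimately show "1 - d < (1 - t ^ m) ^ n" by simp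
  next
    fix t assume t: "b \<le> t" "t \<le> 1"
    have t0: "0 < t" using t assms by simp
    have le: "t ^ m \<le> 1" "0 < t ^ m" using t t0 by (auto simp: power_le_one)
    have "(b / c) ^ m = (1 / c) ^ m * b ^ m" by (simp add: power_divide)
    also have "\<dots> \<le> real n * t ^ m"
      using n t assms by (intro mult_mono power_mono) auto
    finally have nt: "(b / c) ^ m \<le> real n * t ^ m" .
    have pos: "0 < (b / c) ^ m" using c assms by simp
    \<comment> \<open>The inequality \<open>1 + y \<le> exp y\<close> is used twice: for
      \<open>y = - (t ^ m)\<close> to pass to an exponential, then for
      \<open>y = real n * t ^ m\<close> to bound that exponential by the inverse of a large
      number.\<close>
    have "(1 - t ^ m) ^ n \<le> exp (- (t ^ m)) ^ n"
      using le exp_ge_add_one_self[of "- (t ^ m)"] by (intro power_mono) auto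
    also have "\<dots> = inverse (exp (real n * t ^ m))"
      by (simp add: exp_of_nat_mult exp_minus power_inverse)
    also have "\<dots> \<le> inverse ((b / c) ^ m)"
      using nt pos exp_ge_add_one_self[of "real n * t ^ m"] by (intro le_imp_inverse_le) linarith+
    also have "\<dots> = (c / b) ^ m" by (simp add: power_divide)
    finally show "(1 - t ^ m) ^ n < d" using m by simp
  qed
qed

text \<open>Compactness as an induction principle: finitely many of the sets \<open>U\<close> from
  \<open>step\<close> cover \<open>K\<close>, and they are added to the empty set one at a time. It
  serves below once for separation and once for approximation.\<close>

lemma compact_cover_induct:
  assumes K: "compact K" and empty: "P {}"
    and step: "\<And>x. x \<in> K \<Longrightarrow> \<exists>U. open U \<and> x \<in> U \<and> (\<forall>A\<subseteq>K. P A \<longrightarrow> P (A \<union> K \<inter> U))"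
  shows "P K"
proof -
  obtain U where U: "\<And>x. x \<in> K \<Longrightarrow> open (U x)" "\<And>x. x \<in> K \<Longrightarrow> x \<in> U x"
    "\<And>x A. x \<in> K \<Longrightarrow> A \<subseteq> K \<Longrightarrow> P A \<Longrightarrow> P (A \<union> K \<inter> U x)"
    using step by metis
  have "K \<subseteq> (\<Union>x\<in>K. U x)" using U by blast
  then obtain D where D: "D \<subseteq> K" "finite D" "K \<subseteq> (\<Union>x\<in>D. U x)"
    using compactE_image[OF K, of K U] U(1) by metis
  have "P (K \<inter> (\<Union>x\<in>D. U x))"
    using D(2,1)
  proof (induction D rule: finite_induct)
    case (insert x F)
    then have "P (K \<inter> (\<Union>x\<in>F. U x) \<union> K \<inter> U x)" by (intro U(3)) auto
    then show ?case by (simp add: Un_commute Int_Un_distrib)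
  qed (simp add: empty)
  then show ?thesis using D(3) by (simp add: inf.absorb1)
qed

text \<open>For one \<open>y\<close>, a separating multiplier is sharpened to be near 1 around
  \<open>x\<close> and near 0 around \<open>y\<close>; over a finite cover of \<open>C\<close> such
  functions are multiplied. The neighbourhood \<open>U\<close> is fixed before the accuracy
  \<open>d\<close>, so that the gluing argument can choose its cover first and its accuracy
  afterwards.\<close>

lemma multiplier_separates_compact:
  assumes C: "compact C"
    and sep: "\<And>y. y \<in> C \<Longrightarrow> \<exists>p\<in>multipliers M. p x \<noteq> p y"
  shows "\<exists>U. open U \<and> x \<in> U \<and>
    (\<forall>d>0. \<exists>p\<in>multipliers M. (\<forall>z\<in>U. 1 - d < p z) \<and> (\<forall>z\<in>C. p z < d))"
  using C
proof (rule compact_cover_induct)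
  show "\<exists>U. open U \<and> x \<in> U \<and>
      (\<forall>d>0. \<exists>p\<in>multipliers M. (\<forall>z\<in>U. 1 - d < p z) \<and> (\<forall>z\<in>{}. p z < d))"
    using multipliers_one by (intro exI[of _ UNIV]) (auto intro!: bexI[of _ "\<lambda>_. 1"])
next
  fix y assume "y \<in> C"
  then obtain q where q: "q \<in> multipliers M" "q x \<noteq> q y" using sep by blast
  obtain r where r: "r \<in> multipliers M" "r x < r y"
  proof (cases "q x < q y")
    case True
    then show ?thesis using q that by blast
  next
    case False
    then have "1 - q x < 1 - q y" using q by simp
    then show ?thesis using that[of "\<lambda>x. 1 - q x"] multipliers_complement[OF q(1)] by simp
  qed
  note r' = unit_cont_funsD[OF multipliers_unit[OF r(1)]]
  \<comment> \<open>Two levels between \<open>r x\<close> and \<open>r y\<close> leave the gap that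
    \<open>power_sharpening\<close> requires: \<open>r\<close> stays below \<open>a\<close> near
    \<open>x\<close> and above \<open>b\<close> near \<open>y\<close>.\<close>
  obtain a where a: "r x < a" "a < r y" using r dense by blast
  obtain b where b: "a < b" "b < r y" using a dense by blast
  have ab: "0 \<le> a" "b \<le> 1" using a b r'(2)[of x] r'(3)[of y] by auto
  define V where "V = {z. b < r z}"
  have "open {z. r z < a}" "open V"
    unfolding V_def using r'(1) by (auto intro!: open_Collect_less)
  show "\<exists>V. open V \<and> y \<in> V \<and> (\<forall>A\<subseteq>C. (\<exists>U. open U \<and> x \<in> U \<and>
      (\<forall>d>0. \<exists>p\<in>multipliers M. (\<forall>z\<in>U. 1 - d < p z) \<and> (\<forall>z\<in>A. p z < d))) \<longrightarrow>
      (\<exists>U. open U \<and> x \<in> U \<and>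
      (\<forall>d>0. \<exists>p\<in>multipliers M. (\<forall>z\<in>U. 1 - d < p z) \<and> (\<forall>z\<in>A \<union> C \<inter> V. p z < d))))"
  proof (rule exI[of _ V], intro conjI allI impI)
    show "y \<in> V" using b by (simp add: V_def)
    fix A assume "A \<subseteq> C" "\<exists>U. open U \<and> x \<in> U \<and>
      (\<forall>d>0. \<exists>p\<in>multipliers M. (\<forall>z\<in>U. 1 - d < p z) \<and> (\<forall>z\<in>A. p z < d))"
    then obtain U where U: "open U" "x \<in> U"
      "\<And>d. d > 0 \<Longrightarrow> \<exists>p\<in>multipliers M. (\<forall>z\<in>U. 1 - d < p z) \<and> (\<forall>z\<in>A. p z < d)"
      by blast
    have "\<exists>p\<in>multipliers M. (\<forall>z\<in>U \<inter> {z. r z < a}. 1 - d < p z) \<and> (\<forall>z\<in>A \<union> C \<inter> V. p z < d)"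
      if d: "d > 0" for d :: real
    proof -
      obtain p where p: "p \<in> multipliers M" "\<forall>z\<in>U. 1 - d / 2 < p z" "\<forall>z\<in>A. p z < d / 2"
        using U(3)[of "d / 2"] d by auto
      obtain m n where
        mn: "\<And>t. 0 \<le> t \<Longrightarrow> t \<le> a \<Longrightarrow> 1 - d / 2 < (1 - t ^ m) ^ n"
          "\<And>t. b \<le> t \<Longrightarrow> t \<le> 1 \<Longrightarrow> (1 - t ^ m) ^ n < d / 2"
        using power_sharpening[of a b "d / 2"] ab b d by auto
      define s where "s z = (1 - r z ^ m) ^ n" for z
      have s: "s \<in> multipliers M"
        unfolding s_def by (intro multipliers_power multipliers_complement r)
      note p' = unit_cont_funsD[OF multipliers_unit[OF p(1)]]
      note s' = unit_cont_funsD[OF multipliers_unit[OF s]]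
      show ?thesis
      proof (intro bexI[of _ "\<lambda>z. p z * s z"] conjI ballI)
        show "(\<lambda>z. p z * s z) \<in> multipliers M" by (intro multipliers_mult p s)
        fix z assume z: "z \<in> U \<inter> {z. r z < a}"
        then have "1 - d / 2 < p z" "1 - d / 2 < s z"
          using p mn(1)[of "r z"] r'(2)[of z] by (auto simp: s_def)
        \<comment> \<open>Expanded, this reads \<open>p z * s z \<ge> p z + s z - 1\<close>, so the
          two defects of at most \<open>d / 2\<close> add up.\<close>
        moreover have "0 \<le> (1 - p z) * (1 - s z)" using p'(3) s'(3) by simp
        ultimately show "1 - d < p z * s z" by (simp add: algebra_simps)
      next
        fix z assume "z \<in> A \<union> C \<inter> V"
        then have "p z < d / 2 \<or> s z < d / 2"
          using p(3) mn(2)[of "r z"] r'(3)[of z] by (auto simp: s_def V_def)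
        moreover have "p z * s z \<le> p z" "p z * s z \<le> s z"
          using p'(2,3)[of z] s'(2,3)[of z] by (auto simp: mult_left_le mult_left_le_one_le)
        ultimately show "p z * s z < d" using d by linarith
      qed
    qed
    then show "\<exists>U. open U \<and> x \<in> U \<and>
      (\<forall>d>0. \<exists>p\<in>multipliers M. (\<forall>z\<in>U. 1 - d < p z) \<and> (\<forall>z\<in>A \<union> C \<inter> V. p z < d))"
      using U(1,2) a \<open>open {z. r z < a}\<close>
      by (intro exI[of _ "U \<inter> {z. r z < a}"]) auto
  qed fact
qed

section \<open>Gluing local approximants\<close>

lemma convex_combination_error:
  fixes p u v f :: real
  assumes "0 \<le> p" "p \<le> 1"
  shows "\<bar>p * u + (1 - p) * v - f\<bar> \<le> p * \<bar>u - f\<bar> + (1 - p) * \<bar>v - f\<bar>"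
proof -
  have "p * u + (1 - p) * v - f = p * (u - f) + (1 - p) * (v - f)"
    by (simp add: algebra_simps)
  also have "\<bar>\<dots>\<bar> \<le> \<bar>p * (u - f)\<bar> + \<bar>(1 - p) * (v - f)\<bar>" by (rule abs_triangle_ineq)
  also have "\<dots> = p * \<bar>u - f\<bar> + (1 - p) * \<bar>v - f\<bar>" using assms by (simp add: abs_mult)
  finally show ?thesis .
qed

text \<open>Near \<open>x\<close> the function \<open>w\<close> is good; the points of
  \<open>K\<close> where it is bad form a compact set that multipliers separate from
  \<open>x\<close>. An approximant \<open>g\<close> on \<open>A\<close> is therefore replaced by
  \<open>p * w + (1 - p) * g\<close>, with \<open>p\<close> near 1 around \<open>x\<close> and near
  0 where \<open>w\<close> is bad. Each extension costs half of the slack \<open>d\<close>, which is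
  harmless because the inductive statement holds for all \<open>d\<close>.\<close>

lemma multiplier_approximation:
  assumes M: "M \<subseteq> unit_cont_funs" "M \<noteq> {}"
    and f: "f \<in> unit_cont_funs" and K: "compact K" and e: "0 < e"
    and local: "\<And>x. x \<in> K \<Longrightarrow> \<exists>w\<in>M. \<bar>w x - f x\<bar> < e \<and>
      (\<forall>y\<in>K. e \<le> \<bar>w y - f y\<bar> \<longrightarrow> (\<exists>p\<in>multipliers M. p x \<noteq> p y))"
  shows "\<forall>d>0. \<exists>g\<in>M. \<forall>x\<in>K. \<bar>g x - f x\<bar> < e + d"
  using K
proof (rule compact_cover_induct)
  show "\<forall>d>0. \<exists>g\<in>M. \<forall>x\<in>{}. \<bar>g x - f x\<bar> < e + d" using M by auto
next
  note f' = unit_cont_funsD[OF f]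
  fix x assume x: "x \<in> K"
  obtain w where w: "w \<in> M" "\<bar>w x - f x\<bar> < e"
    "\<And>y. y \<in> K \<Longrightarrow> e \<le> \<bar>w y - f y\<bar> \<Longrightarrow> \<exists>p\<in>multipliers M. p x \<noteq> p y"
    using local[OF x] by blast
  have w': "w \<in> unit_cont_funs" using M w(1) by blast
  have N: "open {z. \<bar>w z - f z\<bar> < e}"
    using f'(1) unit_cont_funsD(1)[OF w'] by (auto intro!: open_Collect_less continuous_intros)
  have "compact (K - {z. \<bar>w z - f z\<bar> < e})"
    by (rule compact_diff[OF K N])
  from multiplier_separates_compact[OF this, of M x] w(3) obtain U where U: "open U" "x \<in> U"
    "\<And>d. d > 0 \<Longrightarrow> \<exists>p\<in>multipliers M. (\<forall>z\<in>U. 1 - d < p z) \<and>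
      (\<forall>z\<in>K - {z. \<bar>w z - f z\<bar> < e}. p z < d)"
    by (auto simp: not_less)
  let ?U = "U \<inter> {z. \<bar>w z - f z\<bar> < e}"
  have extend: "\<exists>g\<in>M. \<forall>x\<in>A \<union> K \<inter> ?U. \<bar>g x - f x\<bar> < e + d"
    if A: "\<forall>d>0. \<exists>g\<in>M. \<forall>x\<in>A. \<bar>g x - f x\<bar> < e + d" and AK: "A \<subseteq> K" and d: "0 < d" for A d
  proof -
    obtain g where g: "g \<in> M" "\<forall>x\<in>A. \<bar>g x - f x\<bar> < e + d / 2"
      using A[rule_format, OF half_gt_zero[OF d]] by blast
    obtain p where p: "p \<in> multipliers M" "\<forall>z\<in>U. 1 - d / 2 < p z"
      "\<forall>z\<in>K - {z. \<bar>w z - f z\<bar> < e}. p z < d / 2"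
      using U(3)[OF half_gt_zero[OF d]] by blast
    note p' = unit_cont_funsD[OF multipliers_unit[OF p(1)]]
    \<comment> \<open>Errors never exceed 1, so a term whose weight is below \<open>d / 2\<close>
      contributes less than \<open>d / 2\<close>.\<close>
    have le1: "\<bar>h z - f z\<bar> \<le> 1" if "h \<in> M" for h z
      using unit_cont_funsD(2,3)[of h z] f'(2,3)[of z] M that by (auto simp: abs_if subset_iff)
    have "\<bar>p z * w z + (1 - p z) * g z - f z\<bar> < e + d" if z: "z \<in> A \<union> K \<inter> ?U" for z
    proof -
      define a b where "a = \<bar>w z - f z\<bar>" and "b = \<bar>g z - f z\<bar>"
      have ab: "a \<le> 1" "b \<le> 1" "0 \<le> a" "0 \<le> b"
        unfolding a_def b_def by (intro le1 w(1) g(1) abs_ge_zero)+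
      have pz: "0 \<le> p z" "p z \<le> 1" using p'(2,3) by auto
      have small_p: "p z < d / 2" if "z \<in> A" "\<not> a < e"
        using that p(3) AK unfolding a_def by blast
      have large_p: "1 - d / 2 < p z" "a < e" if "z \<in> ?U"
        using that p(2) unfolding a_def by blast+
      have small_b: "b < e + d / 2" if "z \<in> A"
        using that g(2) unfolding b_def by blast
      have "\<bar>p z * w z + (1 - p z) * g z - f z\<bar> \<le> p z * a + (1 - p z) * b"
        unfolding a_def b_def using pz by (rule convex_combination_error)
      also have "p z * a + (1 - p z) * b < e + d"
      proof -
        have p1: "p z * a \<le> a" "p z * a \<le> p z" "(1 - p z) * b \<le> b" "(1 - p z) * b \<le> 1 - p z"
          using ab pz by (simp_all add: mult_left_le mult_left_le_one_le)
        \<comment> \<open>Either both approximants are good at \<open>z\<close>, or only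
          \<open>g\<close> is and \<open>p z\<close> nearly cancels \<open>w\<close>, or
          \<open>z\<close> lies near \<open>x\<close>, where \<open>w\<close> is good and
          \<open>1 - p z\<close> nearly cancels \<open>g\<close>.\<close>
        consider "z \<in> A" "a < e" | "z \<in> A" "\<not> a < e" | "z \<in> ?U"
          using z by blast
        then show ?thesis
        proof cases
          case 1
          have "p z * a + (1 - p z) * b \<le> p z * (e + d / 2) + (1 - p z) * (e + d / 2)"
            using pz 1(2) small_b[OF 1(1)] d by (intro add_mono mult_left_mono) simp_all
          also have "\<dots> = e + d / 2" by (simp add: field_simps)
          finally show ?thesis using d by simp
        next
          case 2
          then show ?thesis using p1(2,3) small_p small_b by fastforce
        next
          case 3
          then show ?thesis using p1(1,4) large_p d by fastforce
        qed
      qed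
      finally show ?thesis .
    qed
    then show ?thesis by (intro bexI[OF _ multipliersD[OF p(1) w(1) g(1)]] ballI)
  qed
  show "\<exists>U. open U \<and> x \<in> U \<and> (\<forall>A\<subseteq>K. (\<forall>d>0. \<exists>g\<in>M. \<forall>x\<in>A. \<bar>g x - f x\<bar> < e + d) \<longrightarrow>
      (\<forall>d>0. \<exists>g\<in>M. \<forall>x\<in>A \<union> K \<inter> U. \<bar>g x - f x\<bar> < e + d))"
  proof (rule exI[of _ ?U], intro conjI allI impI)
    show "open ?U" using U(1) N by (rule open_Int)
    show "x \<in> ?U" using U(2) w(2) by simp
  qed (rule extend)
qed

section \<open>Values of a self-multiplier at one point\<close>

text \<open>The maps \<open>s \<mapsto> a * s\<close> and \<open>s \<mapsto> a + (1 - a) * s\<close> preserve the set and contract the unit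
  interval onto \<open>{0..a}\<close> and \<open>{a..1}\<close>.\<close>

lemma self_multiplier_values_dense:
  fixes A :: "real set"
  assumes closed: "\<And>p s t. p \<in> A \<Longrightarrow> s \<in> A \<Longrightarrow> t \<in> A \<Longrightarrow> p * s + (1 - p) * t \<in> A"
    and A: "0 \<in> A" "1 \<in> A" "a \<in> A" "0 < a" "a < 1"
    and c: "0 \<le> c" "c \<le> 1" and e: "0 < e"
  shows "\<exists>s\<in>A. \<bar>s - c\<bar> < e"
proof -
  \<comment> \<open>The larger of the two contraction ratios.\<close>
  define b where "b = max a (1 - a)"
  \<comment> \<open>The induction varies \<open>c\<close>: each step pulls it back through the map
    whose image contains it, to \<open>c / a\<close> or \<open>(c - a) / (1 - a)\<close>. At the
    start, \<open>0\<close> lies within \<open>b ^ 0 = 1\<close> of every \<open>c\<close>.\<close>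
  have "\<exists>s\<in>A. \<bar>s - c\<bar> \<le> b ^ n" for n
    using c
  proof (induction n arbitrary: c)
    case 0
    then show ?case using A(1) by (auto intro!: bexI[of _ 0])
  next
    case (Suc n)
    show ?case
    proof (cases "c \<le> a")
      case True
      then obtain s where s: "s \<in> A" "\<bar>s - c / a\<bar> \<le> b ^ n"
        using Suc.IH[of "c / a"] Suc.prems A by auto
      have "\<bar>a * s - c\<bar> = a * \<bar>s - c / a\<bar>"
        using A by (simp add: abs_mult_pos' right_diff_distrib)
      also have "\<dots> \<le> b * b ^ n" using s A by (intro mult_mono) (auto simp: b_def)
      finally show ?thesis using closed[OF A(3) s(1) A(1)] by auto
    next
      case False
      let ?c = "(c - a) / (1 - a)"
      obtain s where s: "s \<in> A" "\<bar>s - ?c\<bar> \<le> b ^ n"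
        using Suc.IH[of ?c] Suc.prems A False by auto
      have "a * 1 + (1 - a) * s - c = (1 - a) * (s - ?c)"
        using A by (simp add: field_simps)
      then have "\<bar>a * 1 + (1 - a) * s - c\<bar> = (1 - a) * \<bar>s - ?c\<bar>"
        using A by (simp add: abs_mult)
      also have "\<dots> \<le> b * b ^ n" using s A by (intro mult_mono) (auto simp: b_def)
      finally show ?thesis using closed[OF A(3) A(2) s(1)] by auto
    qed
  qed
  moreover have "0 \<le> b" "b < 1" using A by (auto simp: b_def)
  then obtain n where "b ^ n < e" using e real_arch_pow_inv by blast
  ultimately show ?thesis by (meson le_less_trans)
qed

section \<open>Closures and point evaluations in the two topologies\<close>

lemma topspace_compact_open: "topspace compact_open_topology = cont_funs"
proof
  show "topspace compact_open_topology \<subseteq> cont_funs"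
    by (rule conjunct1[OF openin_compact_open[THEN iffD1, OF openin_topspace]])
  have "openin compact_open_topology cont_funs"
    by (auto simp: openin_compact_open intro!: exI[of _ "{}"] exI[of _ 1])
  then show "cont_funs \<subseteq> topspace compact_open_topology" by (rule openin_subset)
qed

lemma topspace_strict:
  "topspace strict_topology = (bcontfun :: ('a::topological_space \<Rightarrow> real) set)"
proof
  show "topspace strict_topology \<subseteq> (bcontfun :: ('a \<Rightarrow> real) set)"
    by (rule conjunct1[OF openin_strict[THEN iffD1, OF openin_topspace]])
  have "(\<lambda>_::'a. 0) \<in> C0_weights" by (auto simp: C0_weights_def)
  then have "openin strict_topology (bcontfun :: ('a \<Rightarrow> real) set)"
    unfolding openin_strict by (auto intro!: exI[of _ 1])
  then show "bcontfun \<subseteq> topspace (strict_topology :: ('a \<Rightarrow> real) topology)"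
    by (rule openin_subset)
qed

lemma closure_of_compact_openI:
  assumes f: "f \<in> cont_funs" and M: "M \<subseteq> cont_funs"
    and approx: "\<And>K e. compact K \<Longrightarrow> 0 < e \<Longrightarrow> \<exists>g\<in>M. \<forall>x\<in>K. \<bar>g x - f x\<bar> < e"
  shows "f \<in> compact_open_topology closure_of M"
proof -
  have "f \<in> topspace compact_open_topology" using f by (simp add: topspace_compact_open)
  moreover have "\<exists>g\<in>M. g \<in> U" if "f \<in> U" "openin compact_open_topology U" for U
  proof -
    obtain K e where "compact K" "0 < e" "{g \<in> cont_funs. \<forall>x\<in>K. \<bar>g x - f x\<bar> < e} \<subseteq> U"
      using \<open>f \<in> U\<close> \<open>openin compact_open_topology U\<close> unfolding openin_compact_open by blast
    then show ?thesis using approx[of K e] M by blast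
  qed
  ultimately show ?thesis by (auto simp: in_closure_of)
qed

text \<open>A pointwise bound by \<open>e / 2\<close> bounds the supremum by \<open>e / 2\<close>,
  hence strictly below \<open>e\<close>; so pointwise non-strict estimates suffice in
  \<open>approx\<close>.\<close>

lemma closure_of_strictI:
  fixes f :: "'a::topological_space \<Rightarrow> real"
  assumes f: "f \<in> bcontfun" and M: "M \<subseteq> bcontfun"
    and approx: "\<And>v e. v \<in> C0_weights \<Longrightarrow> 0 < e \<Longrightarrow> \<exists>g\<in>M. \<forall>x. v x * \<bar>g x - f x\<bar> \<le> e"
  shows "f \<in> strict_topology closure_of M"
proof -
  have "f \<in> topspace strict_topology" using f by (simp add: topspace_strict)
  moreover have "\<exists>g\<in>M. g \<in> U" if "f \<in> U" "openin strict_topology U" for U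
  proof -
    obtain v e where v: "v \<in> C0_weights" "0 < e"
      "{g \<in> bcontfun. (SUP x. v x * \<bar>g x - f x\<bar>) < e} \<subseteq> U"
      using \<open>f \<in> U\<close> \<open>openin strict_topology U\<close> unfolding openin_strict by blast
    obtain g where g: "g \<in> M" "\<forall>x. v x * \<bar>g x - f x\<bar> \<le> e / 2"
      using approx[of v "e / 2"] v by auto
    have "(SUP x. v x * \<bar>g x - f x\<bar>) \<le> e / 2" using g by (intro cSUP_least) auto
    then show ?thesis using v g(1) M by (intro bexI[of _ g]) auto
  qed
  ultimately show ?thesis by (auto simp: in_closure_of)
qed

text \<open>Evaluation at \<open>x\<close> is continuous because a singleton is compact.\<close>

lemma openin_compact_open_evaluation:
  assumes "open V"
  shows "openin compact_open_topology {g \<in> cont_funs. g x \<in> V}"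
  unfolding openin_compact_open
proof (intro conjI ballI)
  fix f assume "f \<in> {g \<in> cont_funs. g x \<in> V}"
  then obtain e where "0 < e" "\<forall>y. dist y (f x) < e \<longrightarrow> y \<in> V"
    using assms open_dist by blast
  then show "\<exists>K e. compact K \<and> 0 < e \<and>
      {g \<in> cont_funs. \<forall>x\<in>K. \<bar>g x - f x\<bar> < e} \<subseteq> {g \<in> cont_funs. g x \<in> V}"
    by (intro exI[of _ "{x}"] exI[of _ e]) (auto simp: dist_real_def)
qed auto

text \<open>The supremum dominates its term at \<open>x\<close>, so the radius
  \<open>v x * e\<close> controls the value there up to \<open>e\<close>. A weight vanishing at
  \<open>x\<close> gives no control; this is the source of the weight conditions in the
  theorem.\<close>

lemma openin_strict_evaluation:
  assumes "open V" and v: "v \<in> C0_weights" "0 < v x"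
  shows "openin strict_topology {g \<in> bcontfun. g x \<in> V}"
  unfolding openin_strict
proof (intro conjI ballI)
  fix f assume f: "f \<in> {g \<in> bcontfun. g x \<in> V}"
  then obtain e where e: "0 < e" "\<forall>y. dist y (f x) < e \<longrightarrow> y \<in> V"
    using assms open_dist by blast
  have "g x \<in> V" if g: "g \<in> bcontfun" "(SUP x. v x * \<bar>g x - f x\<bar>) < v x * e" for g
  proof -
    have "v x * \<bar>g x - f x\<bar> \<le> (SUP x. v x * \<bar>g x - f x\<bar>)"
      using f g v by (intro cSUP_upper weighted_bdd_above) auto
    then have "v x * \<bar>g x - f x\<bar> < v x * e" using g by simp
    then show ?thesis using e v by (simp add: dist_real_def)
  qed
  then show "\<exists>v\<in>C0_weights. \<exists>e>0.
      {g \<in> bcontfun. (SUP x. v x * \<bar>g x - f x\<bar>) < e} \<subseteq> {g \<in> bcontfun. g x \<in> V}"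
    using v e by (intro bexI[OF _ v(1)] exI[of _ "v x * e"]) auto
qed auto

text \<open>\<open>X\<close> and \<open>F\<close> are kept abstract so that one argument serves both
  topologies: a value outside \<open>C\<close> would give a neighbourhood of \<open>f\<close> that
  misses \<open>M\<close>.\<close>

lemma closure_of_evaluation:
  assumes f: "f \<in> X closure_of M" "f \<in> F" and X: "openin X {g \<in> F. g x \<in> - C}"
    and M: "\<And>m. m \<in> M \<Longrightarrow> m x \<in> C"
  shows "f x \<in> C"
proof (rule ccontr)
  assume "f x \<notin> C"
  then have "f \<in> {g \<in> F. g x \<in> - C}" using f by simp
  then obtain m where "m \<in> M" "m \<in> {g \<in> F. g x \<in> - C}"
    using f(1) X unfolding in_closure_of by meson
  then show False using M by blast
qed

text \<open>The space is split at the level \<open>e\<close> of \<open>v\<close>. The set where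
  \<open>v\<close> is at least \<open>e\<close> is compact, and there uniform approximation beats
  the bounded weight; elsewhere the weight is below \<open>e\<close> and the error is at most
  1.\<close>

lemma strict_approximation:
  assumes M: "M \<subseteq> unit_cont_funs" and f: "f \<in> unit_cont_funs"
    and approx: "\<And>K e. compact K \<Longrightarrow> 0 < e \<Longrightarrow> \<exists>g\<in>M. \<forall>x\<in>K. \<bar>g x - f x\<bar> < e"
    and v: "v \<in> C0_weights" and e: "0 < e"
  shows "\<exists>g\<in>M. \<forall>x. v x * \<bar>g x - f x\<bar> \<le> e"
proof -
  obtain B where B: "\<And>x. v x \<le> B" using C0_weights_bounded[OF v] by blast
  have v0: "0 \<le> v x" for x using v by (simp add: C0_weights_def)
  have B0: "0 \<le> B" using B v0 order_trans by blast
  have "compact {x. e \<le> v x}" using v e by (simp add: C0_weights_def)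
  \<comment> \<open>Dividing by \<open>B + 1\<close> keeps the divisor positive when
    \<open>B\<close> is 0.\<close>
  then obtain g where g: "g \<in> M" "\<forall>x\<in>{x. e \<le> v x}. \<bar>g x - f x\<bar> < e / (B + 1)"
    using approx[of "{x. e \<le> v x}" "e / (B + 1)"] e B0 by auto
  have "v x * \<bar>g x - f x\<bar> \<le> e" for x
  proof (cases "e \<le> v x")
    case True
    then have "v x * \<bar>g x - f x\<bar> \<le> (B + 1) * (e / (B + 1))"
      using g(2) B[of x] B0 by (intro mult_mono) auto
    then show ?thesis using B0 by simp
  next
    case False
    have "\<bar>g x - f x\<bar> \<le> 1"
      using unit_cont_funsD(2,3)[of g x] unit_cont_funsD(2,3)[OF f, of x] M g(1)
      by (auto simp: abs_if subset_iff)
    then have "v x * \<bar>g x - f x\<bar> \<le> v x" using v0 by (simp add: mult_left_le)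
    then show ?thesis using False by simp
  qed
  then show ?thesis using g(1) by blast
qed

section \<open>The closure of a self-multiplier\<close>

text \<open>The strict closure is treated in three conjuncts because weights may be scarce: if 0 is
  the only weight, the strict closure of a nonempty \<open>M\<close> is all of
  \<open>bcontfun\<close>. Equality inside \<open>unit_cont_funs\<close> uses positive weights at
  the points of \<open>S\<close>, to force vanishing there; equality in \<open>bcontfun\<close> uses
  them at every point, to force values in \<open>{0..1}\<close> as well.\<close>

theorem corollary3p6:
  fixes S :: "'a::topological_space set" and M :: "('a \<Rightarrow> real) set"
  assumes "M \<subseteq> unit_cont_funs"
    and "self_multiplier M"
    and "closed S"
    and "\<forall>x\<in>- S. \<forall>y\<in>- S. x \<noteq> y \<longrightarrow> (\<exists>m\<in>M. m x \<noteq> m y)"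
    and "\<forall>t\<in>- S. (\<exists>m\<in>M. m t = 0) \<and> (\<exists>m\<in>M. m t = 1) \<and> (\<exists>m\<in>M. 0 < m t \<and> m t < 1)"
    and "(\<lambda>m. restrict m S) ` M = {restrict (\<lambda>_. 0) S}"
  shows "compact_open_topology closure_of M = {f \<in> unit_cont_funs. \<forall>x\<in>S. f x = 0} \<and>
    {f \<in> unit_cont_funs. \<forall>x\<in>S. f x = 0} \<subseteq> strict_topology closure_of M \<and>
    ((\<forall>x\<in>S. \<exists>v\<in>C0_weights. 0 < v x) \<longrightarrow>
      subtopology strict_topology unit_cont_funs closure_of M
        = {f \<in> unit_cont_funs. \<forall>x\<in>S. f x = 0}) \<and>
    ((\<forall>x::'a. \<exists>v\<in>C0_weights. 0 < v x) \<longrightarrow>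
      strict_topology closure_of M = {f \<in> unit_cont_funs. \<forall>x\<in>S. f x = 0})"
proof -
  note M = assms(1) and mult = assms(2)
  let ?F = "{f \<in> unit_cont_funs. \<forall>x\<in>S. f x = 0}"
  have MP: "M \<subseteq> multipliers M" by (rule subset_multipliers[OF M mult])
  \<comment> \<open>Condition (iii) is an equality of sets of restrictions, so it yields an element
    of \<open>M\<close> even for empty \<open>S\<close>.\<close>
  have nonempty: "M \<noteq> {}" using assms(6) by blast
  have vanish: "m x = 0" if "m \<in> M" "x \<in> S" for m x
  proof -
    have "restrict m S = restrict (\<lambda>_. 0) S" using assms(6) that(1) by blast
    then have "restrict m S x = restrict (\<lambda>_. 0) S x" by simp
    then show ?thesis using that(2) by simp
  qed
  have unit: "m x \<in> {0..1}" if "m \<in> M" for m x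
    using unit_cont_funsD(2,3)[OF subsetD[OF M that]] by simp
  have approx: "\<exists>g\<in>M. \<forall>x\<in>K. \<bar>g x - f x\<bar> < e"
    if f: "f \<in> ?F" and K: "compact K" and e: "0 < e" for f K e
  proof -
    have "\<exists>w\<in>M. \<bar>w x - f x\<bar> < e / 2 \<and>
      (\<forall>y\<in>K. e / 2 \<le> \<bar>w y - f y\<bar> \<longrightarrow> (\<exists>p\<in>multipliers M. p x \<noteq> p y))" for x
    proof (cases "x \<in> S")
      case True
      obtain w where w: "w \<in> M" using nonempty by blast
      \<comment> \<open>Both \<open>w\<close> and \<open>f\<close> vanish on \<open>S\<close>, so a
        bad point \<open>y\<close> lies outside \<open>S\<close>, where some member of
        \<open>M\<close> takes the value 1; at \<open>x\<close> that member is 0.\<close>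
      have "\<exists>p\<in>multipliers M. p x \<noteq> p y" if "e / 2 \<le> \<bar>w y - f y\<bar>" for y
      proof -
        have "y \<notin> S" using that f vanish[OF w, of y] e by auto
        then obtain m where "m \<in> M" "m y = 1" using assms(5) by blast
        then show ?thesis using vanish[of m x] True MP by (intro bexI[of _ m]) auto
      qed
      then show ?thesis using w f vanish[OF w True] True e by (intro bexI[of _ w]) auto
    next
      case False
      obtain m0 m1 m2 where m: "m0 \<in> M" "m0 x = 0" "m1 \<in> M" "m1 x = 1"
        "m2 \<in> M" "0 < m2 x" "m2 x < 1"
        using assms(5) False by blast
      have f': "0 \<le> f x" "f x \<le> 1" using f unit_cont_funsD[of f] by auto
      \<comment> \<open>The values at \<open>x\<close> inherit the self-multiplier property, and
        (ii) supplies 0, 1 and an intermediate value.\<close>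
      have "\<exists>s\<in>(\<lambda>m. m x) ` M. \<bar>s - f x\<bar> < e / 2"
      proof (rule self_multiplier_values_dense[where a = "m2 x"])
        show "p * s + (1 - p) * t \<in> (\<lambda>m. m x) ` M"
          if "p \<in> (\<lambda>m. m x) ` M" "s \<in> (\<lambda>m. m x) ` M" "t \<in> (\<lambda>m. m x) ` M" for p s t
          using that mult unfolding self_multiplier_def by (force simp: image_iff)
      qed (use m f' e in \<open>auto simp: image_iff intro: bexI[of _ m0] bexI[of _ m1]\<close>)
      then obtain w where w: "w \<in> M" "\<bar>w x - f x\<bar> < e / 2" by blast
      \<comment> \<open>A bad point in \<open>S\<close> is separated from \<open>x\<close> by
        \<open>m1\<close>, which is 1 at \<open>x\<close>. One outside \<open>S\<close> differs from
        \<open>x\<close>, where \<open>w\<close> is good, so (i) applies.\<close>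
      have "\<exists>p\<in>multipliers M. p x \<noteq> p y" if "e / 2 \<le> \<bar>w y - f y\<bar>" for y
      proof (cases "y \<in> S")
        case True
        then show ?thesis using m(3,4) vanish[of m1 y] MP by (intro bexI[of _ m1]) auto
      next
        case False
        have "x \<noteq> y" using that w(2) by auto
        then show ?thesis using assms(4) False \<open>x \<notin> S\<close> MP by blast
      qed
      then show ?thesis using w by blast
    qed
    then have "\<forall>d>0. \<exists>g\<in>M. \<forall>x\<in>K. \<bar>g x - f x\<bar> < e / 2 + d"
      using f e by (intro multiplier_approximation[OF M nonempty _ K]) auto
    from this[rule_format, of "e / 2"] show ?thesis using e by simp
  qed
  have unit_cont: "unit_cont_funs \<subseteq> (cont_funs :: ('a \<Rightarrow> real) set)"
    by (auto simp: unit_cont_funs_def cont_funs_def)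
  have unit_bcont: "unit_cont_funs \<subseteq> (bcontfun :: ('a \<Rightarrow> real) set)"
    by (auto simp: unit_cont_funs_def bcontfun_def intro: bounded_subset bounded_closed_interval)
  have co_sub: "compact_open_topology closure_of M \<subseteq> ?F"
  proof
    fix f assume f: "f \<in> compact_open_topology closure_of M"
    then have fc: "f \<in> cont_funs"
      by (simp add: in_closure_of topspace_compact_open)
    \<comment> \<open>Having values in \<open>{0..1}\<close> and vanishing on \<open>S\<close> are
      both closed conditions on single values, so each passes to the closure.\<close>
    have ev: "f x \<in> C" if "closed C" "\<And>m. m \<in> M \<Longrightarrow> m x \<in> C" for x C
      by (rule closure_of_evaluation[OF f fc])
        (use that openin_compact_open_evaluation[of "- C"] in \<open>auto simp: open_Compl\<close>)
    have "f x \<in> {0..1}" for x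
      by (rule ev) (use unit in auto)
    moreover have "f x \<in> {0}" if "x \<in> S" for x
      by (rule ev) (use vanish that in auto)
    ultimately show "f \<in> ?F" using fc by (auto simp: unit_cont_funs_def cont_funs_def)
  qed
  have co_sup: "?F \<subseteq> compact_open_topology closure_of M"
  proof
    fix f assume f: "f \<in> ?F"
    show "f \<in> compact_open_topology closure_of M"
      by (rule closure_of_compact_openI) (use f unit_cont M approx[OF f] in auto)
  qed
  have strict_sup: "?F \<subseteq> strict_topology closure_of M"
  proof
    fix f assume f: "f \<in> ?F"
    show "f \<in> strict_topology closure_of M"
      by (rule closure_of_strictI)
        (use f unit_bcont M strict_approximation[OF M _ approx[OF f]] in auto)
  qed
  have bcont: "f \<in> bcontfun" if "f \<in> strict_topology closure_of M" for f
    using that by (simp add: in_closure_of topspace_strict)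
  have ev: "f x \<in> C"
    if f: "f \<in> strict_topology closure_of M" and v: "\<exists>v\<in>C0_weights. 0 < v x"
      and "closed C" "\<And>m. m \<in> M \<Longrightarrow> m x \<in> C" for f x C
  proof -
    obtain v where "v \<in> C0_weights" "0 < v x" using v by blast
    then show ?thesis
      by (intro closure_of_evaluation[OF f bcont[OF f] openin_strict_evaluation])
        (use that in \<open>auto simp: open_Compl\<close>)
  qed
  have vanish_strict: "f x = 0"
    if "f \<in> strict_topology closure_of M" "\<exists>v\<in>C0_weights. 0 < v x" "x \<in> S" for f x
    using ev[OF that(1,2), of "{0}"] vanish that(3) by auto
  \<comment> \<open>Continuity is already part of \<open>bcontfun\<close>; only the range comes from
    evaluations.\<close>
  have unit_strict: "f \<in> unit_cont_funs"
    if f: "f \<in> strict_topology closure_of M" and v: "\<forall>x::'a. \<exists>v\<in>C0_weights. 0 < v x" for f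
  proof -
    have "f x \<in> {0..1}" for x
      by (rule ev[OF f]) (use v unit in auto)
    then show ?thesis using bcont[OF f] by (auto simp: unit_cont_funs_def bcontfun_def)
  qed
  have sub: "subtopology strict_topology unit_cont_funs closure_of M
      = unit_cont_funs \<inter> strict_topology closure_of M"
    using M by (simp add: closure_of_subtopology inf.absorb2)
  show ?thesis
  proof (intro conjI impI)
    show "compact_open_topology closure_of M = ?F" using co_sub co_sup by (rule equalityI)
    show "?F \<subseteq> strict_topology closure_of M" by (rule strict_sup)
    show "subtopology strict_topology unit_cont_funs closure_of M = ?F"
      if "\<forall>x\<in>S. \<exists>v\<in>C0_weights. 0 < v x"
      unfolding sub using strict_sup vanish_strict that by blast
    show "strict_topology closure_of M = ?F" if "\<forall>x::'a. \<exists>v\<in>C0_weights. 0 < v x"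
      using strict_sup vanish_strict unit_strict that by blast
  qed
qed

end
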